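(* Let $\lambda,\mu,\nu>0$ and let $M$ be a positive integer. For $z=0,1,\ldots$ let $p_Z(z):=\lim_{t\to\infty}\mathbb{P}(Z^{\infty}_M(t)=z)$ be the stationary distribution of the Markov process $\{Z^\infty_M(t),t\ge 0\}$ of the number of uncharged vehicles in the charging station with infinitely many parking spaces (see context). Then $$p_Z(z)=\begin{cases}\dfrac{1}{z!}\Big(\dfrac{\lambda}{\nu+\mu}\Big)^z p_Z(0), & z\le M,\\[2mm] \dfrac{1}{M!}\Big(\dfrac{\lambda}{\nu+\mu}\Big)^M\displaystyle\prod_{k=M+1}^{z}\dfrac{\lambda}{M\mu+k\nu}\;p_Z(0), & z>M,\end{cases}$$ where $$p_Z(0)=\Big(\sum_{j=0}^{M}\frac{1}{j!}\Big(\frac{\lambda}{\nu+\mu}\Big)^j+\sum_{j=M+1}^{\infty}\frac{1}{M!}\Big(\frac{\lambda}{\nu+\mu}\Big)^M\prod_{k=M+1}^{j}\frac{\lambda}{M\mu+k\nu}\Big)^{-1}.$$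
   Context: In the charging station with infinitely many parking spaces ($K=\infty$), electric vehicles arrive according to a Poisson process of rate $\lambda$, uncharged vehicles become fully charged at total rate $\mu(z\wedge M)$ when $z$ vehicles are uncharged, and each uncharged vehicle leaves at rate $\nu$. Thus the number of uncharged vehicles $Z^\infty_M(t)$ is a birth-death Markov process on $\{0,1,2,\dots\}$ with birth rate $\lambda$ and death rate $\mu\min\{z,M\}+\nu z$ in state $z$. *)

theory Defs
  imports "HOL-Probability.Probability"
begin

text \<open>Transition functions on a discrete state space: \<open>pmf (P t i) j\<close> is the probability of a
  move from \<open>i\<close> to \<open>j\<close> in time \<open>t\<close>. Only \<open>t \<ge> 0\<close> is meaningful.\<close>

locale transition_semigroup =
  fixes P :: "real \<Rightarrow> 's \<Rightarrow> 's pmf"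
  assumes P_zero: "P 0 i = return_pmf i"
    and Chapman_Kolmogorov: "s \<ge> 0 \<Longrightarrow> t \<ge> 0 \<Longrightarrow> P (s + t) i = bind_pmf (P s i) (P t)"

text \<open>The initial law, that is, the law of \<open>Z 0\<close>, is arbitrary. In the Markov property the past
  before \<open>s\<close> is observed at the finitely many times in \<open>F\<close>, where it takes the values given
  by \<open>x\<close>.\<close>

locale continuous_time_markov_chain =
  prob_space \<Omega> + transition_semigroup P
  for \<Omega> :: "'a measure" and Z :: "real \<Rightarrow> 'a \<Rightarrow> 's" and P :: "real \<Rightarrow> 's \<Rightarrow> 's pmf" +
  assumes Z_measurable: "t \<ge> 0 \<Longrightarrow> Z t \<in> measurable \<Omega> (count_space UNIV)"
    and Markov_property:
      "\<lbrakk> s \<ge> 0; t \<ge> 0; finite F; F \<subseteq> {0..s};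
         \<P>(\<omega> in \<Omega>. Z s \<omega> = i \<and> (\<forall>u\<in>F. Z u \<omega> = x u)) > 0 \<rbrakk> \<Longrightarrow>
       \<P>(\<omega> in \<Omega>. Z (s + t) \<omega> = j \<bar> Z s \<omega> = i \<and> (\<forall>u\<in>F. Z u \<omega> = x u)) = pmf (P t i) j"

definition birth_death_generator ::
  "(nat \<Rightarrow> real) \<Rightarrow> (nat \<Rightarrow> real) \<Rightarrow> nat \<Rightarrow> nat \<Rightarrow> real" where
  "birth_death_generator b d i j =
     (if j = i + 1 then b i
      else if i = j + 1 then d i
      else if j = i then - (b i + d i)
      else 0)"

text \<open>The assumption \<open>infinitesimal_rates\<close> is the usual description
  \<open>P\<^sub>h(i,j) = \<delta>\<^sub>i\<^sub>j + q\<^sub>i\<^sub>j h + o(h)\<close> as \<open>h \<down> 0\<close>. No regularity of the sample paths is required.\<close>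

locale birth_death_process =
  continuous_time_markov_chain \<Omega> Z P
  for \<Omega> :: "'a measure" and Z :: "real \<Rightarrow> 'a \<Rightarrow> nat" and P :: "real \<Rightarrow> nat \<Rightarrow> nat pmf" +
  fixes b d :: "nat \<Rightarrow> real"
  assumes birth_nonneg: "b i \<ge> 0"
    and death_nonneg: "d i \<ge> 0"
    and death_zero: "d 0 = 0"
    and infinitesimal_rates:
      "((\<lambda>h. (pmf (P h i) j - (if j = i then 1 else 0)) / h)
          \<longlongrightarrow> birth_death_generator b d i j) (at_right 0)"

definition stationary_distribution :: "(real \<Rightarrow> 's \<Rightarrow> 's pmf) \<Rightarrow> 's pmf \<Rightarrow> bool" where
  "stationary_distribution P \<pi> \<longleftrightarrow> (\<forall>t\<ge>0. bind_pmf \<pi> (P t) = \<pi>)"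

end

theory Submission
  imports Defs
begin

text \<open>
  Fix a state \<open>j\<close>, let \<open>Q\<close> be the generator with birth rates \<open>b\<close> and death rates \<open>d\<close>, and write
  \<open>u t i\<close> for the probability of moving from \<open>i\<close> to \<open>j\<close> in time \<open>t\<close>.
  The generator is conservative with finite rows, so \<open>u\<close> satisfies Kolmogorov's backward equation
  \<open>u' = Q u\<close> (\<open>backward_equation\<close>). Both halves of the proof rest on this equation.

  Convergence. The differences \<open>w t i = u t (i + 1) - u t i\<close> satisfy a system of the same kind with
  an additional killing term of rate \<open>d (i + 1) - d i + b i - b (i + 1)\<close>. In the charging station
  the births are constant and each further vehicle adds at least \<open>nu\<close> to the death rate, so the
  killing rate is at least \<open>nu > 0\<close>. A maximum principle (\<open>parabolic_comparison\<close>) then gives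
  \<open>\<bar>w t i\<bar> \<le> exp (- nu * t)\<close> (\<open>transition_difference_bound\<close>): the process forgets its starting
  point. Hence the law at time \<open>t\<close> converges to any stationary distribution there is, and there is
  at most one (\<open>law_tendsto_stationary\<close>).

  Existence and the formula. The product weights \<open>\<Prod>k=1..z. b (k - 1) / d k\<close> solve the detailed
  balance equations and are summable, since \<open>d k \<ge> nu * k\<close>. Normalized, they form a stationary
  distribution (\<open>detailed_balance_stationary\<close>), because by detailed balance the derivative of
  \<open>\<Sum>i\<le>n. \<pi> i * u t i\<close> is the single term \<open>\<pi> n * b n * w t n\<close>, which tends to \<open>0\<close> as \<open>n\<close> grows.
  The stated product formula is the evaluation of these weights for the given rates, and the
  value at \<open>0\<close> is the inverse of their total mass.
\<close>

section \<open>Expectations under a probability mass function\<close>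

text \<open>Outside \<open>K\<close> the integrand is at most \<open>C\<close> and the mass is \<open>1 - p(K)\<close>. Applied to
  \<open>P h i\<close>, this bounds the tail of an infinite sum by finitely many transition probabilities, and
  these have known rates.\<close>
lemma pmf_expectation_truncation_error:
  fixes f :: "'s \<Rightarrow> real"
  assumes "finite K" and f: "\<And>x. \<bar>f x\<bar> \<le> C"
  shows "\<bar>measure_pmf.expectation p f - (\<Sum>k\<in>K. pmf p k * f k)\<bar> \<le> C * (1 - (\<Sum>k\<in>K. pmf p k))"
proof -
  have bounded: "integrable p g" if "\<And>x. \<bar>g x\<bar> \<le> C" for g :: "'s \<Rightarrow> real"
    using that by (intro measure_pmf.integrable_const_bound[where B = C]) auto
  have C: "C \<ge> 0"
    using f[of undefined] by linarith
  have inside: "measure_pmf.expectation p (\<lambda>x. f x * indicator K x) = (\<Sum>k\<in>K. pmf p k * f k)"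
    using \<open>finite K\<close>
    by (subst integral_measure_pmf_real[where A = K]) (auto simp: indicator_def mult.commute intro!: sum.cong)
  have "measure_pmf.expectation p f =
      measure_pmf.expectation p (\<lambda>x. f x * indicator K x + f x * indicator (- K) x)"
    by (intro arg_cong[where f = "measure_pmf.expectation p"]) (auto simp: fun_eq_iff indicator_def)
  also have "\<dots> = (\<Sum>k\<in>K. pmf p k * f k) + measure_pmf.expectation p (\<lambda>x. f x * indicator (- K) x)"
    using inside C f by (subst Bochner_Integration.integral_add) (auto intro!: bounded simp: indicator_def)
  finally have split: "measure_pmf.expectation p f - (\<Sum>k\<in>K. pmf p k * f k) =
      measure_pmf.expectation p (\<lambda>x. f x * indicator (- K) x)"
    by simp
  have "\<bar>measure_pmf.expectation p (\<lambda>x. f x * indicator (- K) x)\<bar> \<le>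
      measure_pmf.expectation p (\<lambda>x. \<bar>f x * indicator (- K) x\<bar>)"
    by (rule integral_abs_bound)
  also have "\<dots> \<le> measure_pmf.expectation p (\<lambda>x. C * indicator (- K) x)"
    using C f by (intro integral_mono bounded) (auto simp: indicator_def)
  also have "\<dots> = C * measure p (- K)"
    by simp
  also have "measure p (- K) = 1 - (\<Sum>k\<in>K. pmf p k)"
    using \<open>finite K\<close> measure_pmf.prob_compl[of K p]
    by (simp add: measure_measure_pmf_finite Compl_eq_Diff_UNIV)
  finally show ?thesis
    unfolding split .
qed

lemma sum_atMost_pmf_tendsto_1: "(\<lambda>n. \<Sum>k\<le>n. pmf p k) \<longlonglongrightarrow> 1" for p :: "nat pmf"
proof -
  have "(\<lambda>n. measure p {..n}) \<longlonglongrightarrow> measure p (\<Union>n. {..n})"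
    by (intro measure_pmf.finite_Lim_measure_incseq) (auto simp: incseq_def)
  moreover have "(\<Union>n. {..n::nat}) = UNIV"
    by auto
  ultimately show ?thesis
    using measure_pmf.prob_space[of p] by (simp add: measure_measure_pmf_finite)
qed

lemma pmf_expectation_sums:
  fixes f :: "nat \<Rightarrow> real"
  assumes f: "\<And>x. \<bar>f x\<bar> \<le> C"
  shows "(\<lambda>n. pmf p n * f n) sums measure_pmf.expectation p f"
proof -
  let ?S = "\<lambda>n. \<Sum>k\<le>n. pmf p k * f k"
  have "(\<lambda>n. measure_pmf.expectation p f - ?S n) \<longlonglongrightarrow> 0"
  proof (rule Lim_null_comparison)
    show "\<forall>\<^sub>F n in sequentially. norm (measure_pmf.expectation p f - ?S n) \<le> C * (1 - (\<Sum>k\<le>n. pmf p k))"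
      using pmf_expectation_truncation_error[OF _ f, of "{.._}" p] by (intro always_eventually) simp
    show "(\<lambda>n. C * (1 - (\<Sum>k\<le>n. pmf p k))) \<longlonglongrightarrow> 0"
      by (rule tendsto_eq_intros sum_atMost_pmf_tendsto_1 refl)+ simp
  qed
  from tendsto_diff[OF tendsto_const this, of "measure_pmf.expectation p f"] show ?thesis
    by (simp add: sums_def_le)
qed

lemma normalized_pmf_exists:
  fixes r :: "nat \<Rightarrow> real"
  assumes "\<And>z. r z \<ge> 0" "summable r" "suminf r > 0"
  obtains \<pi> where "\<And>z. pmf \<pi> z = r z / suminf r"
proof
  show "pmf (embed_pmf (\<lambda>z. r z / suminf r)) z = r z / suminf r" for z
  proof (rule pmf_embed_pmf)
    have "(\<Sum>z. ennreal (r z / suminf r)) = ennreal (\<Sum>z. r z / suminf r)"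
      using assms by (intro suminf_ennreal2 summable_divide) auto
    also have "(\<Sum>z. r z / suminf r) = 1"
      using suminf_divide[OF assms(2), of "suminf r"] assms(3) by simp
    finally show "(\<integral>\<^sup>+z. ennreal (r z / suminf r) \<partial>count_space UNIV) = 1"
      by (simp add: nn_integral_count_space_nat)
  qed (use assms in auto)
qed

section \<open>A comparison principle for infinite birth-death systems\<close>

text \<open>A maximum principle: at an interior maximum in time and state the birth and death terms are
  nonpositive, and the killing term makes the solution decay at rate \<open>\<kappa>\<close>. The supremum over the
  infinitely many states may not be attained, so a multiple of \<open>(i + 1) * exp ((A + 1) * t)\<close>
  is subtracted first. It grows in \<open>i\<close>, and it is a strict supersolution because births happen at
  most at rate \<open>A * (i + 1)\<close>, whereas the deaths may be arbitrarily fast, since they lower this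
  function.\<close>
lemma parabolic_comparison:
  fixes w :: "real \<Rightarrow> nat \<Rightarrow> real" and \<alpha> \<beta> c :: "nat \<Rightarrow> real"
  assumes deriv: "\<And>t i. t \<ge> 0 \<Longrightarrow> ((\<lambda>t. w t i) has_real_derivative
      \<alpha> i * (w t (i + 1) - w t i) + \<beta> i * (w t (i - 1) - w t i) - c i * w t i) (at t within {0..})"
    and bound: "\<And>t i. t \<ge> 0 \<Longrightarrow> w t i \<le> B"
    and \<alpha>: "\<And>i. \<alpha> i \<ge> 0" "\<And>i. \<alpha> i \<le> A * (real i + 1)"
    and \<beta>: "\<And>i. \<beta> i \<ge> 0"
    and c: "\<And>i. c i \<ge> \<kappa>"
    and initial: "\<And>i. w 0 i \<le> C" and "C \<ge> 0" and "T \<ge> 0"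
  shows "w T n \<le> C * exp (- \<kappa> * T)"
proof -
  have barrier: "exp (\<kappa> * T) * w T n < C + \<epsilon> * (real n + 1) * exp ((A + 1) * T)" if "\<epsilon> > 0" for \<epsilon>
  proof (rule ccontr)
    define W where "W t i = exp (\<kappa> * t) * w t i" for t i
    define g where "g t i = \<epsilon> * (real i + 1) * exp ((A + 1) * t)" for t i
    define f where "f t i = W t i - C - g t i" for t i
    assume "\<not> ?thesis"
    then have top: "f T n \<ge> 0"
      by (simp add: f_def W_def g_def)
    have A: "A \<ge> 0"
      using \<alpha>[of 0] by simp
    obtain N :: nat where N: "exp (\<bar>\<kappa>\<bar> * T) * \<bar>B\<bar> / \<epsilon> < real N"
      using reals_Archimedean2 by blast
    \<comment> \<open>The barrier \<open>g\<close> is unbounded in \<open>i\<close> and \<open>W\<close> is bounded, so only finitely many states can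
      violate the inequality.\<close>
    have far: "f t i < 0" if "t \<in> {0..T}" "i \<ge> N" for t i
    proof -
      have "W t i \<le> exp (\<kappa> * t) * \<bar>B\<bar>"
        unfolding W_def using bound[of t i] that by (intro mult_left_mono) auto
      also have "\<dots> \<le> exp (\<bar>\<kappa>\<bar> * T) * \<bar>B\<bar>"
        using that by (intro mult_right_mono) (auto intro!: mult_mono)
      also have "\<dots> < \<epsilon> * real N"
        using N \<open>\<epsilon> > 0\<close> by (simp add: field_simps)
      also have "\<dots> \<le> \<epsilon> * (real i + 1) * 1"
        using that \<open>\<epsilon> > 0\<close> by simp
      also have "\<dots> \<le> g t i"
        unfolding g_def using that A \<open>\<epsilon> > 0\<close> by (intro mult_left_mono) auto
      finally show ?thesis
        using \<open>C \<ge> 0\<close> by (simp add: f_def)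
    qed
    have f_deriv: "((\<lambda>t. f t i) has_real_derivative
        \<alpha> i * (W t (i + 1) - W t i) + \<beta> i * (W t (i - 1) - W t i) - (c i - \<kappa>) * W t i
          - (A + 1) * g t i) (at t within {0..})" if "t \<ge> 0" for t i
      unfolding f_def W_def g_def using that
      by (auto intro!: derivative_eq_intros deriv simp: algebra_simps)
    \<comment> \<open>As \<open>f\<close> is nonnegative at \<open>(T, n)\<close>, it attains a global maximum over all states and all
      times in \<open>{0..T}\<close>.\<close>
    have "\<exists>s\<in>{0..T}. \<forall>t\<in>{0..T}. f t i \<le> f s i" for i
    proof (rule continuous_attains_sup)
      show "continuous_on {0..T} (\<lambda>t. f t i)"
        by (rule DERIV_continuous_on, rule DERIV_subset[OF f_deriv]) auto
    qed (use \<open>T \<ge> 0\<close> in auto)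
    then obtain \<tau> where \<tau>: "\<tau> i \<in> {0..T}" "\<And>t. t \<in> {0..T} \<Longrightarrow> f t i \<le> f (\<tau> i) i" for i
      by metis
    obtain m where m: "m \<le> N" "\<And>i. i \<le> N \<Longrightarrow> f (\<tau> i) i \<le> f (\<tau> m) m"
      using finite_imageI[of "{..N}" "\<lambda>i. f (\<tau> i) i"]
        Max_in[of "(\<lambda>i. f (\<tau> i) i) ` {..N}"] Max_ge[of "(\<lambda>i. f (\<tau> i) i) ` {..N}"]
      by (smt (verit) atMost_iff empty_is_image finite_atMost imageE imageI not_empty_eq_Iic_eq_empty)
    have "n < N"
      using far[of T n] top \<open>T \<ge> 0\<close> by force
    then have max_nonneg: "f (\<tau> m) m \<ge> 0"
      using m(2)[of n] \<tau>(2)[of T n] top \<open>T \<ge> 0\<close> by force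
    have max: "f t i \<le> f (\<tau> m) m" if "t \<in> {0..T}" for t i
      using far[OF that, of i] max_nonneg m(2)[of i] \<tau>(2)[OF that, of i] by force
    have "f 0 m < 0"
      unfolding f_def W_def g_def using initial[of m] mult_pos_pos[OF \<open>\<epsilon> > 0\<close>, of "real m + 1"] by simp
    then have pos: "\<tau> m > 0"
      using max_nonneg \<tau>(1)[of m] by (metis atLeastAtMost_iff linorder_not_le order_le_less)
    \<comment> \<open>At the maximum \<open>(t, m)\<close> the differences of \<open>W\<close> are at most those of \<open>g\<close>. The time growth of
      \<open>g\<close>, at rate \<open>A + 1\<close>, outweighs the birth term, which is at most \<open>A * g\<close>.\<close>
    define t where "t = \<tau> m"
    have t: "t > 0" "t \<le> T"
      using pos \<tau>(1)[of m] by (simp_all add: t_def)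
    have up: "W t (m + 1) - W t m \<le> \<epsilon> * exp ((A + 1) * t)"
      using max[of t "m + 1"] t unfolding f_def g_def t_def[symmetric] by (simp add: algebra_simps)
    have "g t (m - 1) \<le> g t m"
      unfolding g_def using \<open>\<epsilon> > 0\<close> by (intro mult_right_mono mult_left_mono) auto
    then have down: "W t (m - 1) - W t m \<le> 0"
      using max[of t "m - 1"] t unfolding f_def t_def[symmetric] by simp
    have g_pos: "g t m > 0"
      unfolding g_def using \<open>\<epsilon> > 0\<close> by simp
    have W_nonneg: "W t m \<ge> 0"
      using max_nonneg \<open>C \<ge> 0\<close> g_pos unfolding f_def t_def[symmetric] by simp
    have "\<alpha> m * (W t (m + 1) - W t m) \<le> \<alpha> m * (\<epsilon> * exp ((A + 1) * t))"
      using up \<alpha>(1) by (rule mult_left_mono)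
    also have "\<dots> \<le> A * (real m + 1) * (\<epsilon> * exp ((A + 1) * t))"
      using \<alpha>(2) \<open>\<epsilon> > 0\<close> by (intro mult_right_mono) auto
    also have "\<dots> = A * g t m"
      by (simp add: g_def)
    finally have "\<alpha> m * (W t (m + 1) - W t m) \<le> A * g t m" .
    moreover have "\<beta> m * (W t (m - 1) - W t m) \<le> 0"
      using down \<beta> by (simp add: mult_nonneg_nonpos)
    moreover have "(c m - \<kappa>) * W t m \<ge> 0"
      using W_nonneg c by simp
    ultimately have neg: "\<alpha> m * (W t (m + 1) - W t m) + \<beta> m * (W t (m - 1) - W t m)
        - (c m - \<kappa>) * W t m - (A + 1) * g t m < 0"
      using g_pos by (simp add: algebra_simps)
    \<comment> \<open>A negative derivative at a maximum with \<open>t > 0\<close> is impossible.\<close>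
    obtain \<delta> where \<delta>: "\<delta> > 0" "\<And>h. h > 0 \<Longrightarrow> t - h \<in> {0..} \<Longrightarrow> h < \<delta> \<Longrightarrow> f t m < f (t - h) m"
      using has_real_derivative_neg_dec_left[OF f_deriv neg] t by auto
    define h where "h = min (\<delta> / 2) t"
    have "h > 0" "h < \<delta>" "h \<le> t"
      using \<delta>(1) t by (auto simp: h_def)
    then have "f t m < f (t - h) m" "t - h \<in> {0..T}"
      using \<delta>(2)[of h] t by auto
    then show False
      using max[of "t - h" m] by (simp add: t_def)
  qed
  have "exp (\<kappa> * T) * w T n \<le> C"
  proof (rule field_le_epsilon)
    fix e :: real assume "e > 0"
    define scale where "scale = (real n + 1) * exp ((A + 1) * T)"
    have "scale > 0"
      by (simp add: scale_def add_nonneg_pos)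
    then show "exp (\<kappa> * T) * w T n \<le> C + e"
      using barrier[of "e / scale"] \<open>e > 0\<close> by (simp add: mult.assoc scale_def[symmetric])
  qed
  then show ?thesis
    by (simp add: exp_minus field_simps)
qed

section \<open>The backward equation\<close>

context birth_death_process
begin

text \<open>The product of the tridiagonal generator with the column \<open>u\<close>. At \<open>i = 0\<close> the truncated
  \<open>i - 1\<close> is \<open>0\<close>, so the second summand vanishes, as it should.\<close>
definition generator_action :: "(nat \<Rightarrow> real) \<Rightarrow> nat \<Rightarrow> real" where
  "generator_action u i = b i * (u (i + 1) - u i) + d i * (u (i - 1) - u i)"

lemma sum_generator:
  "(\<Sum>k\<le>i + 1. birth_death_generator b d i k * u k) = generator_action u i"
proof (cases i)
  case 0
  then show ?thesis
    by (simp add: generator_action_def birth_death_generator_def death_zero algebra_simps)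
next
  case (Suc m)
  have "(\<Sum>k\<le>i + 1. birth_death_generator b d i k * u k) =
      (\<Sum>k\<in>{m, Suc m, Suc (Suc m)}. birth_death_generator b d i k * u k)"
    using Suc by (intro sum.mono_neutral_right) (auto simp: birth_death_generator_def)
  then show ?thesis
    using Suc by (simp add: generator_action_def birth_death_generator_def algebra_simps)
qed

lemma sum_generator_row: "(\<Sum>k\<le>i + 1. birth_death_generator b d i k) = 0"
  using sum_generator[of i "\<lambda>_. 1"] by (simp add: generator_action_def)

text \<open>The rows of the generator are finite and sum to zero. Hence \<open>P h i\<close> puts mass \<open>o(h)\<close> outside
  \<open>{..i + 1}\<close>, although the rates are only given entry by entry, and the states beyond \<open>i + 1\<close>
  contribute nothing to the limit for a bounded integrand. The integrand may vary with \<open>h\<close>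
  because the left derivative in the backward equation needs \<open>P (t - h)\<close> in place of \<open>P t\<close>.\<close>
lemma rescaled_increment_tendsto_generator_action:
  fixes v :: "real \<Rightarrow> nat \<Rightarrow> real"
  assumes v: "\<And>k. ((\<lambda>h. v h k) \<longlongrightarrow> u k) (at_right 0)"
    and bound: "\<And>h k. \<bar>v h k\<bar> \<le> C"
  shows "((\<lambda>h. (measure_pmf.expectation (P h i) (v h) - v h i) / h) \<longlongrightarrow> generator_action u i) (at_right 0)"
proof -
  define q where "q h k = (pmf (P h i) k - (if k = i then 1 else 0)) / h" for h k
  have q: "((\<lambda>h. q h k) \<longlongrightarrow> birth_death_generator b d i k) (at_right 0)" for k
    unfolding q_def by (rule infinitesimal_rates)
  have main: "((\<lambda>h. \<Sum>k\<le>i + 1. q h k * v h k) \<longlongrightarrow> generator_action u i) (at_right 0)"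
    unfolding sum_generator[symmetric] by (intro tendsto_sum tendsto_mult q v)
  have "((\<lambda>h. C * - (\<Sum>k\<le>i + 1. q h k)) \<longlongrightarrow> C * - (\<Sum>k\<le>i + 1. birth_death_generator b d i k))
      (at_right 0)"
    by (intro tendsto_intros q)
  then have tail: "((\<lambda>h. C * - (\<Sum>k\<le>i + 1. q h k)) \<longlongrightarrow> 0) (at_right 0)"
    unfolding sum_generator_row by simp
  have "((\<lambda>h. (measure_pmf.expectation (P h i) (v h) - v h i) / h
        - (\<Sum>k\<le>i + 1. q h k * v h k)) \<longlongrightarrow> 0) (at_right 0)"
  proof (rule Lim_null_comparison[OF _ tail])
    have "\<bar>(measure_pmf.expectation (P h i) (v h) - v h i) / h - (\<Sum>k\<le>i + 1. q h k * v h k)\<bar>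
        \<le> C * - (\<Sum>k\<le>i + 1. q h k)" if "h > 0" for h
    proof -
      have q_sum: "(\<Sum>k\<le>i + 1. q h k * g k) = ((\<Sum>k\<le>i + 1. pmf (P h i) k * g k) - g i) / h"
        for g :: "nat \<Rightarrow> real"
      proof -
        have "(\<Sum>k\<le>i + 1. q h k * g k) =
            (\<Sum>k\<le>i + 1. pmf (P h i) k * g k - (if k = i then g k else 0)) / h"
          unfolding q_def sum_divide_distrib by (intro sum.cong) (auto simp: algebra_simps)
        then show ?thesis
          by (simp add: sum_subtractf)
      qed
      have "(measure_pmf.expectation (P h i) (v h) - v h i) / h - (\<Sum>k\<le>i + 1. q h k * v h k) =
          (measure_pmf.expectation (P h i) (v h) - (\<Sum>k\<le>i + 1. pmf (P h i) k * v h k)) / h"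
        unfolding q_sum by (simp add: diff_divide_distrib)
      moreover have "C * - (\<Sum>k\<le>i + 1. q h k) = C * (1 - (\<Sum>k\<le>i + 1. pmf (P h i) k)) / h"
        using q_sum[of "\<lambda>_. 1"]
        by (simp add: right_diff_distrib' diff_divide_distrib del: sum.atMost_Suc)
      ultimately show ?thesis
        using pmf_expectation_truncation_error[of "{..i + 1}" "v h" C "P h i"] bound that
        by (simp add: abs_divide divide_right_mono del: sum.atMost_Suc)
    qed
    then show "\<forall>\<^sub>F h in at_right 0. norm ((measure_pmf.expectation (P h i) (v h) - v h i) / h
        - (\<Sum>k\<le>i + 1. q h k * v h k)) \<le> C * - (\<Sum>k\<le>i + 1. q h k)"
      by (auto simp: eventually_at_right_less intro: eventually_mono[OF eventually_at_right_less])
  qed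
  from tendsto_add[OF this main] show ?thesis
    by simp
qed

text \<open>This is the continuity of the semigroup at time \<open>0\<close>, a consequence of the finite rates.\<close>
lemma holding_probability_tendsto_1: "((\<lambda>h. pmf (P h k) k) \<longlongrightarrow> 1) (at_right 0)"
proof -
  have "((\<lambda>h. 1 + h * ((pmf (P h k) k - (if k = k then 1 else 0)) / h)) \<longlongrightarrow>
      1 + 0 * birth_death_generator b d k k) (at_right 0)"
    by (intro tendsto_intros infinitesimal_rates)
  then have "((\<lambda>h. 1 + h * ((pmf (P h k) k - (if k = k then 1 else 0)) / h)) \<longlongrightarrow> 1) (at_right 0)"
    by simp
  then show ?thesis
    by (rule tendsto_cong[THEN iffD1, rotated])
      (auto simp: P_zero intro!: eventually_mono[OF eventually_at_right_less[of 0]])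
qed

lemma pmf_transition_add:
  assumes "s \<ge> 0" "t \<ge> 0"
  shows "pmf (P (s + t) i) j = measure_pmf.expectation (P s i) (\<lambda>k. pmf (P t k) j)"
  using Chapman_Kolmogorov[OF assms] by (simp add: pmf_bind)

text \<open>Splitting off the first step of length \<open>h\<close> turns \<open>P t\<close> into an average of \<open>P (t - h)\<close> that is
  concentrated at the starting state.\<close>
lemma transition_left_continuous:
  assumes "t > 0"
  shows "((\<lambda>h. pmf (P (t - h) k) j) \<longlongrightarrow> pmf (P t k) j) (at_right 0)"
proof -
  have small: "\<forall>\<^sub>F h in at_right 0. 0 < h \<and> h < t"
    using assms by (auto simp: eventually_at_right intro!: exI[of _ t])
  have "((\<lambda>h. 2 * (1 - pmf (P h k) k)) \<longlongrightarrow> 2 * (1 - 1)) (at_right 0)"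
    by (intro tendsto_intros holding_probability_tendsto_1)
  then have lim: "((\<lambda>h. 2 * (1 - pmf (P h k) k)) \<longlongrightarrow> 0) (at_right 0)"
    by simp
  have "((\<lambda>h. pmf (P (t - h) k) j - pmf (P t k) j) \<longlongrightarrow> 0) (at_right 0)"
  proof (rule Lim_null_comparison[OF eventually_mono[OF small] lim])
    fix h assume h: "0 < h \<and> h < t"
    have "pmf (P t k) j = measure_pmf.expectation (P h k) (\<lambda>x. pmf (P (t - h) x) j)"
      using pmf_transition_add[of h "t - h" k j] h by simp
    moreover have "\<bar>measure_pmf.expectation (P h k) (\<lambda>x. pmf (P (t - h) x) j)
        - pmf (P h k) k * pmf (P (t - h) k) j\<bar> \<le> 1 - pmf (P h k) k"
      using pmf_expectation_truncation_error[of "{k}" "\<lambda>x. pmf (P (t - h) x) j" 1 "P h k"]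
      by (simp add: pmf_le_1)
    moreover have "\<bar>pmf (P h k) k * pmf (P (t - h) k) j - pmf (P (t - h) k) j\<bar> \<le> 1 - pmf (P h k) k"
    proof -
      have "\<bar>pmf (P h k) k * pmf (P (t - h) k) j - pmf (P (t - h) k) j\<bar> =
          (1 - pmf (P h k) k) * pmf (P (t - h) k) j"
        using mult_right_mono[of "pmf (P h k) k" 1 "pmf (P (t - h) k) j"]
        by (simp add: pmf_le_1 algebra_simps)
      also have "\<dots> \<le> (1 - pmf (P h k) k) * 1"
        by (intro mult_left_mono) (auto simp: pmf_le_1)
      finally show ?thesis by simp
    qed
    ultimately show "norm (pmf (P (t - h) k) j - pmf (P t k) j) \<le> 2 * (1 - pmf (P h k) k)"
      by simp
  qed
  then show ?thesis
    by (simp add: LIM_zero_iff)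
qed

text \<open>Conditioning on the first short step makes the increment of \<open>P\<close> an expectation under
  \<open>P h i\<close>. The derivative is two-sided for \<open>t > 0\<close>: the maximum principle needs the left
  derivative at a maximum, which the semigroup property gives together with left continuity.\<close>
theorem backward_equation:
  assumes "t \<ge> 0"
  shows "((\<lambda>t. pmf (P t i) j) has_real_derivative generator_action (\<lambda>k. pmf (P t k) j) i) (at t within {0..})"
proof -
  let ?u = "\<lambda>t k. pmf (P t k) j"
  have right: "((\<lambda>h. (?u (t + h) i - ?u t i) / h) \<longlongrightarrow> generator_action (?u t) i) (at_right 0)"
  proof (rule tendsto_cong[THEN iffD1, rotated])
    show "((\<lambda>h. (measure_pmf.expectation (P h i) (?u t) - ?u t i) / h) \<longlongrightarrow> generator_action (?u t) i) (at_right 0)"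
      by (intro rescaled_increment_tendsto_generator_action[where C = 1]) (auto simp: pmf_le_1)
    show "\<forall>\<^sub>F h in at_right 0. (measure_pmf.expectation (P h i) (?u t) - ?u t i) / h =
        (?u (t + h) i - ?u t i) / h"
      using assms pmf_transition_add[of _ t i j]
      by (intro eventually_mono[OF eventually_at_right_less[of 0]]) (simp add: add.commute)
  qed
  show ?thesis
  proof (cases "t = 0")
    case True
    then show ?thesis
      using right by (simp add: has_field_derivative_iff at_within_Ici_at_right)
  next
    case False
    with assms have "t > 0" by simp
    \<comment> \<open>The step of length \<open>h\<close> starts at time \<open>0\<close> and is followed by \<open>P (t - h)\<close>.\<close>
    have "((\<lambda>h. (?u (t - h) i - ?u t i) / - h) \<longlongrightarrow> generator_action (?u t) i) (at_right 0)"
    proof (rule tendsto_cong[THEN iffD1, rotated])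
      show "((\<lambda>h. (measure_pmf.expectation (P h i) (?u (t - h)) - ?u (t - h) i) / h)
          \<longlongrightarrow> generator_action (?u t) i) (at_right 0)"
        using transition_left_continuous[OF \<open>t > 0\<close>]
        by (intro rescaled_increment_tendsto_generator_action[where C = 1]) (auto simp: pmf_le_1)
      have "\<forall>\<^sub>F h in at_right 0. 0 < h \<and> h < t"
        using \<open>t > 0\<close> by (auto simp: eventually_at_right intro!: exI[of _ t])
      then show "\<forall>\<^sub>F h in at_right 0. (measure_pmf.expectation (P h i) (?u (t - h)) - ?u (t - h) i) / h =
          (?u (t - h) i - ?u t i) / - h"
      proof eventually_elim
        case (elim h)
        then show ?case
          using pmf_transition_add[of h "t - h" i j] by (simp add: field_simps)
      qed
    qed
    then have left: "((\<lambda>h. (?u (t + h) i - ?u t i) / h) \<longlongrightarrow> generator_action (?u t) i) (at_left 0)"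
      by (subst at_left_minus) (simp add: filterlim_filtermap)
    have "((\<lambda>t. ?u t i) has_real_derivative generator_action (?u t) i) (at t)"
      unfolding DERIV_def using left right by (rule filterlim_split_at)
    then show ?thesis
      by (rule has_field_derivative_at_within)
  qed
qed

section \<open>Contraction of the semigroup\<close>

text \<open>Differences of neighbouring rows again solve a birth-death system, with births \<open>b (i + 1)\<close>,
  deaths \<open>d i\<close> and killing at rate \<open>d (i + 1) - d i + b i - b (i + 1)\<close>. Where \<open>d\<close>
  increases and \<open>b\<close> decreases, this is the analytic form of a monotone coupling of two copies at
  \<open>i\<close> and \<open>i + 1\<close>, whose gap closes at the killing rate.\<close>
theorem transition_difference_bound:
  assumes gap: "\<And>i. d (i + 1) - d i + b i - b (i + 1) \<ge> \<kappa>"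
    and growth: "\<And>i. b (i + 1) \<le> A * (real i + 1)"
    and "t \<ge> 0"
  shows "\<bar>pmf (P t (i + 1)) j - pmf (P t i) j\<bar> \<le> exp (- \<kappa> * t)"
proof -
  define w where "w t i = pmf (P t (i + 1)) j - pmf (P t i) j" for t i
  have deriv: "((\<lambda>t. w t i) has_real_derivative
      b (i + 1) * (w t (i + 1) - w t i) + d i * (w t (i - 1) - w t i)
        - (d (i + 1) - d i + b i - b (i + 1)) * w t i) (at t within {0..})" if "t \<ge> 0" for t i
  proof -
    let ?u = "\<lambda>k. pmf (P t k) j"
    have "generator_action ?u (i + 1) - generator_action ?u i = b (i + 1) * (w t (i + 1) - w t i)
        + d i * (w t (i - 1) - w t i) - (d (i + 1) - d i + b i - b (i + 1)) * w t i"
      unfolding generator_action_def w_def by (cases i) (auto simp: death_zero algebra_simps)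
    then show ?thesis
      using DERIV_diff[OF backward_equation[OF that, of "i + 1" j] backward_equation[OF that, of i j]]
      by (simp add: w_def)
  qed
  have le_1: "w t i \<le> 1" "- w t i \<le> 1" for t i
    using pmf_le_1[of "P t (i + 1)" j] pmf_le_1[of "P t i" j]
      pmf_nonneg[of "P t (i + 1)" j] pmf_nonneg[of "P t i" j]
    unfolding w_def by linarith+
  have "w t i \<le> 1 * exp (- \<kappa> * t)"
    using deriv le_1 birth_nonneg death_nonneg gap growth \<open>t \<ge> 0\<close>
    by (intro parabolic_comparison[where \<alpha> = "\<lambda>i. b (i + 1)" and \<beta> = d and B = 1 and A = A
          and c = "\<lambda>i. d (i + 1) - d i + b i - b (i + 1)"]) auto
  moreover have "- w t i \<le> 1 * exp (- \<kappa> * t)"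
  proof (rule parabolic_comparison[where \<alpha> = "\<lambda>i. b (i + 1)" and \<beta> = d and B = 1 and A = A
          and c = "\<lambda>i. d (i + 1) - d i + b i - b (i + 1)" and w = "\<lambda>t i. - w t i"])
    fix t :: real and i assume "t \<ge> 0"
    from DERIV_minus[OF deriv[OF this, of i]]
    show "((\<lambda>t. - w t i) has_real_derivative
        b (i + 1) * (- w t (i + 1) - - w t i) + d i * (- w t (i - 1) - - w t i)
        - (d (i + 1) - d i + b i - b (i + 1)) * - w t i) (at t within {0..})"
      by (rule DERIV_cong) (simp add: algebra_simps)
  qed (use le_1 birth_nonneg death_nonneg gap growth \<open>t \<ge> 0\<close> in auto)
  ultimately show ?thesis
    by (simp add: w_def)
qed

section \<open>Stationary distributions and convergence\<close>

lemma pmf_transition_0: "pmf (P 0 i) j = (if i = j then 1 else 0)"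
  by (simp add: P_zero indicator_def)

text \<open>Under detailed balance \<open>\<Sum>i\<le>n. \<pi> i * (Q u) i\<close> telescopes to a single boundary term, in absolute
  value at most the probability flow from \<open>n\<close> to \<open>n + 1\<close>. So the partial sums of \<open>\<Sum>i. \<pi> i * P t i j\<close> have a small
  derivative in \<open>t\<close>, and no interchange of derivative and infinite sum has to be justified.\<close>
theorem detailed_balance_stationary:
  assumes balance: "\<And>i. pmf \<pi> i * b i = pmf \<pi> (i + 1) * d (i + 1)"
    and flux: "(\<lambda>n. pmf \<pi> n * b n) \<longlonglongrightarrow> 0"
  shows "stationary_distribution P \<pi>"
  unfolding stationary_distribution_def
proof (intro allI impI pmf_eqI)
  fix t :: real and j assume "t \<ge> 0"
  define S where "S n t = (\<Sum>i\<le>n. pmf \<pi> i * pmf (P t i) j)" for n t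
  have telescope: "(\<Sum>i\<le>n. pmf \<pi> i * generator_action u i) = pmf \<pi> n * b n * (u (n + 1) - u n)" for n u
  proof (induction n)
    case 0
    then show ?case by (simp add: generator_action_def death_zero)
  next
    case (Suc n)
    have "pmf \<pi> n * b n * (u (n + 1) - u n) + pmf \<pi> (n + 1) * d (n + 1) * (u n - u (n + 1)) = 0"
      unfolding balance by (simp add: algebra_simps)
    with Suc show ?case
      by (simp add: generator_action_def algebra_simps)
  qed
  have change: "norm (S n t - S n 0) \<le> pmf \<pi> n * b n * t" for n
  proof -
    have "norm (S n t - S n 0) \<le> pmf \<pi> n * b n * norm (t - 0)"
    proof (rule field_differentiable_bound[where S = "{0..}"])
      fix s :: real assume s: "s \<in> {0..}"
      have "(S n has_real_derivative (\<Sum>i\<le>n. pmf \<pi> i * generator_action (\<lambda>k. pmf (P s k) j) i)) (at s within {0..})"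
        unfolding S_def using s by (intro DERIV_sum DERIV_cmult backward_equation) auto
      then show "(S n has_real_derivative pmf \<pi> n * b n * (pmf (P s (n + 1)) j - pmf (P s n) j))
          (at s within {0..})"
        unfolding telescope .
      have "\<bar>pmf (P s (n + 1)) j - pmf (P s n) j\<bar> \<le> 1"
        using pmf_le_1[of "P s (n + 1)" j] pmf_le_1[of "P s n" j]
          pmf_nonneg[of "P s (n + 1)" j] pmf_nonneg[of "P s n" j] by linarith
      then show "norm (pmf \<pi> n * b n * (pmf (P s (n + 1)) j - pmf (P s n) j)) \<le> pmf \<pi> n * b n"
        using birth_nonneg[of n] by (simp add: abs_mult mult_left_le)
    qed (use \<open>t \<ge> 0\<close> in auto)
    then show ?thesis
      using \<open>t \<ge> 0\<close> by simp
  qed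
  have "(\<lambda>n. pmf \<pi> n * b n * t) \<longlonglongrightarrow> 0"
    using tendsto_mult_left_zero[OF flux, of t] .
  then have "(\<lambda>n. S n t - S n 0) \<longlonglongrightarrow> 0"
    by (rule Lim_null_comparison[OF always_eventually[OF allI[OF change]]])
  moreover have "(\<lambda>n. S n 0) \<longlonglongrightarrow> pmf \<pi> j"
  proof (rule tendsto_eventually)
    show "\<forall>\<^sub>F n in sequentially. S n 0 = pmf \<pi> j"
      using eventually_ge_at_top[of j]
    proof eventually_elim
      case (elim n)
      then have "S n 0 = (\<Sum>i\<le>n. if i = j then pmf \<pi> i else 0)"
        unfolding S_def by (intro sum.cong) (auto simp: pmf_transition_0)
      with elim show ?case by simp
    qed
  qed
  ultimately have "(\<lambda>n. (S n t - S n 0) + S n 0) \<longlonglongrightarrow> 0 + pmf \<pi> j"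
    by (rule tendsto_add)
  then have "(\<lambda>n. S n t) \<longlonglongrightarrow> pmf \<pi> j"
    by simp
  moreover have "(\<lambda>n. S n t) \<longlonglongrightarrow> pmf (bind_pmf \<pi> (P t)) j"
    using pmf_expectation_sums[of "\<lambda>i. pmf (P t i) j" 1 \<pi>]
    by (simp add: S_def sums_def_le pmf_bind pmf_le_1)
  ultimately show "pmf (bind_pmf \<pi> (P t)) j = pmf \<pi> j"
    by (rule LIMSEQ_unique[symmetric])
qed

text \<open>All rows of \<open>P t\<close> merge with row \<open>0\<close>, by summing the bounds on neighbouring rows. Hence so do
  all mixtures of rows, whatever the initial law, and the mixture by \<open>\<pi>\<close> is constantly \<open>\<pi>\<close>.\<close>
theorem law_tendsto_stationary:
  assumes "\<kappa> > 0"
    and gap: "\<And>i. d (i + 1) - d i + b i - b (i + 1) \<ge> \<kappa>"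
    and growth: "\<And>i. b (i + 1) \<le> A * (real i + 1)"
    and stationary: "stationary_distribution P \<pi>"
  shows "((\<lambda>t. pmf (bind_pmf \<mu> (P t)) j) \<longlongrightarrow> pmf \<pi> j) at_top"
proof -
  have from_0: "((\<lambda>t. pmf (P t i) j - pmf (P t 0) j) \<longlongrightarrow> 0) at_top" for i
  proof (induction i)
    case (Suc i)
    have "((\<lambda>t. pmf (P t (i + 1)) j - pmf (P t i) j) \<longlongrightarrow> 0) at_top"
    proof (rule Lim_null_comparison)
      show "\<forall>\<^sub>F t in at_top. norm (pmf (P t (i + 1)) j - pmf (P t i) j) \<le> exp (- \<kappa> * t)"
        using eventually_ge_at_top[of 0]
        by eventually_elim (simp add: transition_difference_bound[OF gap growth, simplified])
      show "((\<lambda>t. exp (- \<kappa> * t)) \<longlongrightarrow> 0) at_top"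
        using filterlim_tendsto_pos_mult_at_top[OF tendsto_const \<open>\<kappa> > 0\<close> filterlim_ident]
        by (intro filterlim_compose[OF exp_at_bot]) (simp add: filterlim_uminus_at_top)
    qed
    from tendsto_add[OF this Suc] show ?case by simp
  qed simp
  have mix: "((\<lambda>t. pmf (bind_pmf \<rho> (P t)) j - pmf (P t 0) j) \<longlongrightarrow> 0) at_top" for \<rho>
  proof -
    have "((\<lambda>t. measure_pmf.expectation \<rho> (\<lambda>i. pmf (P t i) j - pmf (P t 0) j)) \<longlongrightarrow>
        measure_pmf.expectation \<rho> (\<lambda>i. 0)) at_top"
      using from_0
      by (intro integral_dominated_convergence_at_top[where w = "\<lambda>_. 1"])
        (auto intro!: always_eventually simp: abs_le_iff pmf_le_1 add_increasing2 le_diff_eq diff_le_eq)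
    moreover have "measure_pmf.expectation \<rho> (\<lambda>i. pmf (P t i) j - pmf (P t 0) j) =
        pmf (bind_pmf \<rho> (P t)) j - pmf (P t 0) j" for t
      unfolding pmf_bind
      by (subst Bochner_Integration.integral_diff)
        (auto intro!: measure_pmf.integrable_const_bound[where B = 1] simp: pmf_le_1)
    ultimately show ?thesis by simp
  qed
  have "((\<lambda>t. pmf (bind_pmf \<mu> (P t)) j - pmf (bind_pmf \<pi> (P t)) j) \<longlongrightarrow> 0) at_top"
    using tendsto_diff[OF mix[of \<mu>] mix[of \<pi>]] by simp
  then have "((\<lambda>t. pmf (bind_pmf \<mu> (P t)) j - pmf \<pi> j) \<longlongrightarrow> 0) at_top"
    by (rule tendsto_cong[THEN iffD1, rotated])
      (use stationary in \<open>auto simp: stationary_distribution_def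
        intro!: eventually_mono[OF eventually_ge_at_top[of 0]]\<close>)
  then show ?thesis
    by (simp add: LIM_zero_iff)
qed

lemma stationary_distribution_unique:
  assumes "\<kappa> > 0"
    and "\<And>i. d (i + 1) - d i + b i - b (i + 1) \<ge> \<kappa>"
    and "\<And>i. b (i + 1) \<le> A * (real i + 1)"
    and "stationary_distribution P \<pi>" "stationary_distribution P \<pi>'"
  shows "\<pi>' = \<pi>"
proof (rule pmf_eqI)
  fix j
  have "((\<lambda>t. pmf (bind_pmf \<pi> (P t)) j) \<longlongrightarrow> pmf \<pi> j) at_top"
    and "((\<lambda>t. pmf (bind_pmf \<pi> (P t)) j) \<longlongrightarrow> pmf \<pi>' j) at_top"
    using assms(4,5) by (auto intro: law_tendsto_stationary[OF assms(1-3)])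
  then show "pmf \<pi>' j = pmf \<pi> j"
    using tendsto_unique trivial_limit_at_top_linorder by blast
qed

section \<open>The law of the process\<close>

text \<open>The Markov property with an empty past, summed over the value of \<open>Z 0\<close>. It is silent about
  initial states of probability zero, which do not contribute to the sum.\<close>
lemma law_eq_bind_initial_law:
  "\<exists>\<mu>. \<forall>t\<ge>0. \<forall>z. \<P>(\<omega> in \<Omega>. Z t \<omega> = z) = pmf (bind_pmf \<mu> (P t)) z"
proof -
  have meas: "Z t \<in> measurable \<Omega> (count_space UNIV)" if "t \<ge> 0" for t
    using Z_measurable that by simp
  define r where "r i = \<P>(\<omega> in \<Omega>. Z 0 \<omega> = i)" for i
  have "r sums prob (\<Union>i. {\<omega> \<in> space \<Omega>. Z 0 \<omega> = i})"
    unfolding r_def using meas[of 0]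
    by (intro finite_measure_UNION) (auto simp: disjoint_family_on_def)
  moreover have "(\<Union>i. {\<omega> \<in> space \<Omega>. Z 0 \<omega> = i}) = space \<Omega>"
    by auto
  ultimately have "r sums 1"
    by (simp add: prob_space)
  then have "summable r" "suminf r = 1"
    by (auto simp: sums_iff)
  then obtain \<mu> where "\<And>i. pmf \<mu> i = r i / suminf r"
    using normalized_pmf_exists[of r] by (auto simp: r_def)
  with \<open>suminf r = 1\<close> have pmf_\<mu>: "pmf \<mu> i = \<P>(\<omega> in \<Omega>. Z 0 \<omega> = i)" for i
    by (simp add: r_def)
  have "\<P>(\<omega> in \<Omega>. Z t \<omega> = z) = pmf (bind_pmf \<mu> (P t)) z" if t: "t \<ge> 0" for t z
  proof -
    define E where "E i = {\<omega> \<in> space \<Omega>. Z t \<omega> = z \<and> Z 0 \<omega> = i}" for i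
    have [measurable]: "Z t \<in> measurable \<Omega> (count_space UNIV)" "Z 0 \<in> measurable \<Omega> (count_space UNIV)"
      using t meas by auto
    have E: "E i \<in> sets \<Omega>" for i
      unfolding E_def by measurable
    have "prob (E i) = pmf \<mu> i * pmf (P t i) z" for i
    proof (cases "pmf \<mu> i = 0")
      case True
      have "prob (E i) \<le> prob {\<omega> \<in> space \<Omega>. Z 0 \<omega> = i}"
        unfolding E_def by (intro finite_measure_mono) auto
      with True show ?thesis
        using measure_nonneg[of \<Omega> "E i"] by (simp add: pmf_\<mu>)
    next
      case False
      then have "prob {\<omega> \<in> space \<Omega>. Z 0 \<omega> = i} > 0"
        using pmf_\<mu>[of i] pmf_nonneg[of \<mu> i] by linarith
      with Markov_property[of 0 t "{}" i undefined z] t show ?thesis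
        by (simp add: cond_prob_def pmf_\<mu> E_def field_simps)
    qed
    moreover have "(\<lambda>i. prob (E i)) sums prob (\<Union>i. E i)"
      using E by (intro finite_measure_UNION) (auto simp: disjoint_family_on_def E_def)
    moreover have "(\<Union>i. E i) = {\<omega> \<in> space \<Omega>. Z t \<omega> = z}"
      by (auto simp: E_def)
    ultimately have "(\<lambda>i. pmf \<mu> i * pmf (P t i) z) sums \<P>(\<omega> in \<Omega>. Z t \<omega> = z)"
      by simp
    moreover have "(\<lambda>i. pmf \<mu> i * pmf (P t i) z) sums pmf (bind_pmf \<mu> (P t)) z"
      unfolding pmf_bind by (rule pmf_expectation_sums[where C = 1]) (simp add: pmf_le_1)
    ultimately show ?thesis
      by (rule sums_unique2)
  qed
  then show ?thesis
    by blast
qed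

end

section \<open>Solution of the balance equations\<close>

definition balance_weight :: "(nat \<Rightarrow> real) \<Rightarrow> (nat \<Rightarrow> real) \<Rightarrow> nat \<Rightarrow> real" where
  "balance_weight b d z = (\<Prod>k=1..z. b (k - 1) / d k)"

lemma balance_weight_0 [simp]: "balance_weight b d 0 = 1"
  by (simp add: balance_weight_def)

lemma balance_weight_Suc: "balance_weight b d (Suc z) = balance_weight b d z * (b z / d (Suc z))"
  by (simp add: balance_weight_def)

text \<open>Bounded births and at least linear deaths: the weights are dominated by those of an
  immigration-death chain, whose equilibrium is a Poisson distribution. Hence they are summable.\<close>
lemma balance_weight_le_exp_term:
  assumes "\<And>z. 0 \<le> b z" "\<And>z. b z \<le> B" and "\<nu> > 0" "\<And>z. d (Suc z) \<ge> \<nu> * real (Suc z)"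
  shows "0 \<le> balance_weight b d z" "balance_weight b d z \<le> (B / \<nu>) ^ z / fact z"
proof -
  have d: "d (Suc z) > 0" for z
    using assms(4)[of z] \<open>\<nu> > 0\<close> by (meson less_le_trans mult_pos_pos of_nat_0_less_iff zero_less_Suc)
  show nonneg: "0 \<le> balance_weight b d z" for z
    by (induction z) (auto simp: balance_weight_Suc assms(1) d less_imp_le)
  show "balance_weight b d z \<le> (B / \<nu>) ^ z / fact z"
  proof (induction z)
    case (Suc z)
    have "b z / d (Suc z) \<le> B / (\<nu> * real (Suc z))"
      using assms(1,2,4)[of z] \<open>\<nu> > 0\<close> by (intro frac_le) (auto intro: order_trans)
    then have "balance_weight b d (Suc z) \<le> (B / \<nu>) ^ z / fact z * (B / (\<nu> * real (Suc z)))"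
      unfolding balance_weight_Suc
      using Suc nonneg[of z] assms(1)[of z] d[of z] by (intro mult_mono) (auto intro: order_trans)
    then show ?case
      by (simp add: field_simps)
  qed simp
qed

text \<open>Up to \<open>M\<close> uncharged vehicles are all being charged, so that the death rate is
  \<open>(nu + mu) * z\<close>; of any larger number only \<open>M\<close> are.\<close>
lemma balance_weight_charging_station:
  fixes lam mu nu :: real
  assumes "mu > 0" "nu > 0"
  shows "balance_weight (\<lambda>_. lam) (\<lambda>z. mu * real (min z M) + nu * real z) z =
    (if z \<le> M then 1 / fact z * (lam / (nu + mu)) ^ z
     else 1 / fact M * (lam / (nu + mu)) ^ M * (\<Prod>k=M+1..z. lam / (real M * mu + real k * nu)))"
proof (induction z)
  case (Suc z)
  consider "Suc z \<le> M" | "z = M" | "z > M" by linarith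
  then show ?case
  proof cases
    case 1
    have "mu * real (Suc z) + nu * real (Suc z) = (nu + mu) * real (Suc z)"
      by (simp add: algebra_simps)
    with 1 Suc show ?thesis
      by (simp add: balance_weight_Suc min_absorb1 mult_ac del: of_nat_Suc)
  next
    case 2
    with Suc show ?thesis
      by (simp add: balance_weight_Suc mult.commute)
  next
    case 3
    with Suc show ?thesis
      by (simp add: balance_weight_Suc min_absorb2 mult.commute prod.cl_ivl_Suc)
  qed
qed simp

theorem proposition3p3:
  fixes lam mu nu :: real and M :: nat
    and \<Omega> :: "'a measure" and Z :: "real \<Rightarrow> 'a \<Rightarrow> nat" and P :: "real \<Rightarrow> nat \<Rightarrow> nat pmf"
    and p\<^sub>Z :: "nat \<Rightarrow> real"
  assumes "lam > 0" and "mu > 0" and "nu > 0" and "M > 0"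
    and "birth_death_process \<Omega> Z P (\<lambda>z. lam) (\<lambda>z. mu * real (min z M) + nu * real z)"
    and p\<^sub>Z_def: "\<And>z. p\<^sub>Z z = Lim at_top (\<lambda>t. \<P>(\<omega> in \<Omega>. Z t \<omega> = z))"
  shows
    "(\<forall>z. ((\<lambda>t. \<P>(\<omega> in \<Omega>. Z t \<omega> = z)) \<longlongrightarrow> p\<^sub>Z z) at_top) \<and>
     (\<exists>!\<pi>. stationary_distribution P \<pi>) \<and>
     (\<forall>\<pi>. stationary_distribution P \<pi> \<longrightarrow> (\<forall>z. pmf \<pi> z = p\<^sub>Z z)) \<and>
     (\<forall>z. p\<^sub>Z z =
        (if z \<le> M then 1 / fact z * (lam / (nu + mu)) ^ z * p\<^sub>Z 0
         else 1 / fact M * (lam / (nu + mu)) ^ M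
                * (\<Prod>k=M+1..z. lam / (real M * mu + real k * nu)) * p\<^sub>Z 0)) \<and>
     (\<lambda>j. 1 / fact M * (lam / (nu + mu)) ^ M
            * (\<Prod>k=M+1..j. lam / (real M * mu + real k * nu))) summable_on {M+1..} \<and>
     p\<^sub>Z 0 =
       inverse ((\<Sum>j=0..M. 1 / fact j * (lam / (nu + mu)) ^ j)
         + (\<Sum>\<^sub>\<infinity>j\<in>{M+1..}. 1 / fact M * (lam / (nu + mu)) ^ M
              * (\<Prod>k=M+1..j. lam / (real M * mu + real k * nu))))"
proof -
  define d where "d z = mu * real (min z M) + nu * real z" for z
  interpret birth_death_process \<Omega> Z P "\<lambda>_. lam" d
    using assms(5) by (simp add: d_def[abs_def])
  define r where "r = balance_weight (\<lambda>_. lam) d"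
  define tail where "tail j = 1 / fact M * (lam / (nu + mu)) ^ M
    * (\<Prod>k=M+1..j. lam / (real M * mu + real k * nu))" for j
  have r: "r z = (if z \<le> M then 1 / fact z * (lam / (nu + mu)) ^ z else tail z)" for z
    using balance_weight_charging_station[OF \<open>mu > 0\<close> \<open>nu > 0\<close>, of lam M z]
    by (simp add: r_def tail_def d_def[abs_def])
  have d_growth: "d (Suc z) \<ge> nu * real (Suc z)" for z
    unfolding d_def using \<open>mu > 0\<close> by simp
  then have d_pos: "d (Suc z) > 0" for z
    using \<open>nu > 0\<close> by (meson less_le_trans mult_pos_pos of_nat_0_less_iff zero_less_Suc)
  \<comment> \<open>Each additional vehicle raises the death rate by at least its own rate of leaving.\<close>
  have gap: "d (i + 1) - d i + lam - lam \<ge> nu" for i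
    unfolding d_def using \<open>mu > 0\<close> by (simp add: algebra_simps)
  have growth: "lam \<le> lam * (real i + 1)" for i
    using \<open>lam > 0\<close> by simp
  have r_nonneg: "r z \<ge> 0" and r_le: "r z \<le> (lam / nu) ^ z / fact z" for z
    unfolding r_def using balance_weight_le_exp_term[of "\<lambda>_. lam" lam nu d z] d_growth \<open>lam > 0\<close> \<open>nu > 0\<close>
    by simp_all
  have summable: "summable r"
  proof (rule summable_comparison_test')
    show "summable (\<lambda>z. (lam / nu) ^ z / fact z)"
      using summable_exp[of "lam / nu"] by (simp add: field_simps)
    show "norm (r z) \<le> (lam / nu) ^ z / fact z" if "z \<ge> 0" for z
      using r_nonneg r_le by simp
  qed
  have r_has_sum: "(r has_sum suminf r) UNIV"
    using summable r_nonneg by (intro sums_nonneg_imp_has_sum) (auto simp: summable_sums)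
  have "0 < r 0" "r 0 \<le> suminf r"
    using sum_le_suminf[OF summable, of "{0}"] r_nonneg by (auto simp: r)
  then have total_pos: "suminf r > 0" by simp
  obtain \<pi> where \<pi>: "\<And>z. pmf \<pi> z = r z / suminf r"
    using normalized_pmf_exists[OF r_nonneg summable total_pos] by blast
  have stationary: "stationary_distribution P \<pi>"
  proof (rule detailed_balance_stationary)
    show "pmf \<pi> i * lam = pmf \<pi> (i + 1) * d (i + 1)" for i
      using d_pos[of i] by (simp add: \<pi> r_def balance_weight_Suc)
    have "(\<lambda>n. r n / suminf r * lam) \<longlonglongrightarrow> 0 / suminf r * lam"
      using total_pos by (intro tendsto_intros summable_LIMSEQ_zero[OF summable]) auto
    then show "(\<lambda>n. pmf \<pi> n * lam) \<longlonglongrightarrow> 0"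
      by (simp add: \<pi>)
  qed
  have unique: "\<pi>' = \<pi>" if "stationary_distribution P \<pi>'" for \<pi>'
    using stationary_distribution_unique[OF \<open>nu > 0\<close> gap growth stationary that] .
  obtain \<mu> where \<mu>: "\<And>t z. t \<ge> 0 \<Longrightarrow> \<P>(\<omega> in \<Omega>. Z t \<omega> = z) = pmf (bind_pmf \<mu> (P t)) z"
    using law_eq_bind_initial_law by blast
  have limit: "((\<lambda>t. \<P>(\<omega> in \<Omega>. Z t \<omega> = z)) \<longlongrightarrow> pmf \<pi> z) at_top" for z
  proof (rule tendsto_cong[THEN iffD1, rotated])
    show "((\<lambda>t. pmf (bind_pmf \<mu> (P t)) z) \<longlongrightarrow> pmf \<pi> z) at_top"
      by (rule law_tendsto_stationary[OF \<open>nu > 0\<close> gap growth stationary])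
    show "\<forall>\<^sub>F t in at_top. pmf (bind_pmf \<mu> (P t)) z = \<P>(\<omega> in \<Omega>. Z t \<omega> = z)"
      using eventually_ge_at_top[of 0] by eventually_elim (simp add: \<mu>)
  qed
  have p\<^sub>Z: "p\<^sub>Z z = r z / suminf r" for z
    unfolding p\<^sub>Z_def \<pi>[symmetric] by (rule tendsto_Lim[OF _ limit]) simp
  have p\<^sub>Z_0: "p\<^sub>Z 0 = inverse (suminf r)"
    by (simp add: p\<^sub>Z r divide_inverse)
  have tail_summable: "tail summable_on {M+1..}"
  proof (rule summable_on_cong[THEN iffD1])
    show "r summable_on {M+1..}"
      using r_has_sum by (rule summable_on_subset_banach[OF has_sum_imp_summable]) simp
    show "r j = tail j" if "j \<in> {M+1..}" for j
      using that by (simp add: r)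
  qed
  have total: "suminf r = (\<Sum>j=0..M. 1 / fact j * (lam / (nu + mu)) ^ j) + (\<Sum>\<^sub>\<infinity>j\<in>{M+1..}. tail j)"
  proof -
    have "(tail has_sum (\<Sum>\<^sub>\<infinity>j\<in>{M+1..}. tail j)) {M+1..}"
      using tail_summable by (rule has_sum_infsum)
    then have "(r has_sum (\<Sum>\<^sub>\<infinity>j\<in>{M+1..}. tail j)) {M+1..}"
      by (rule has_sum_cong[THEN iffD1, rotated]) (simp add: r)
    moreover have "(r has_sum (\<Sum>j=0..M. r j)) {0..M}"
      by (rule has_sum_finite) simp
    ultimately have "(r has_sum (\<Sum>j=0..M. r j) + (\<Sum>\<^sub>\<infinity>j\<in>{M+1..}. tail j)) ({0..M} \<union> {M+1..})"
      by (intro has_sum_Un_disjoint) auto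
    moreover have "{0..M} \<union> {M+1..} = UNIV" by auto
    ultimately have "suminf r = (\<Sum>j=0..M. r j) + (\<Sum>\<^sub>\<infinity>j\<in>{M+1..}. tail j)"
      using has_sum_unique[OF r_has_sum] by simp
    then show ?thesis
      by (simp add: r)
  qed
  show ?thesis
    unfolding tail_def[symmetric]
  proof (intro conjI allI impI)
    show "((\<lambda>t. \<P>(\<omega> in \<Omega>. Z t \<omega> = z)) \<longlongrightarrow> p\<^sub>Z z) at_top" for z
      using limit by (simp add: p\<^sub>Z \<pi>)
    show "\<exists>!\<pi>. stationary_distribution P \<pi>"
      using stationary unique by blast
    show "pmf \<pi>' z = p\<^sub>Z z" if "stationary_distribution P \<pi>'" for \<pi>' z
      using unique[OF that] by (simp add: p\<^sub>Z \<pi>)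
    show "p\<^sub>Z z = (if z \<le> M then 1 / fact z * (lam / (nu + mu)) ^ z * p\<^sub>Z 0 else tail z * p\<^sub>Z 0)" for z
      unfolding p\<^sub>Z_0 by (simp add: p\<^sub>Z r divide_inverse)
    show "tail summable_on {M+1..}"
      by (rule tail_summable)
    show "p\<^sub>Z 0 = inverse ((\<Sum>j=0..M. 1 / fact j * (lam / (nu + mu)) ^ j) + (\<Sum>\<^sub>\<infinity>j\<in>{M+1..}. tail j))"
      using p\<^sub>Z_0 total by simp
  qed
qed

end
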